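(* Let $X,Y,Z$ be locally convex Hausdorff topological vector spaces, and let $F\colon X\rightrightarrows Y$ be a generalized polyhedral convex multifunction whose graph is given by $$\mathrm{gph}\,F=\big\{(x,y)\in X\times Y\;\big|\;A_1(x)+A_2(y)=z,\ \langle x_i^*,x\rangle+\langle y_i^*,y\rangle\le\beta_i,\ i=1,\dots,m\big\},$$ where $A_1\colon X\to Z$ and $A_2\colon Y\to Z$ are continuous linear mappings, $z\in Z$, and $x_i^*\in X^*$, $y_i^*\in Y^*$, $\beta_i\in\mathbb{R}$ for $i=1,\dots,m$. If the mapping $A_2$ is closed under finite-codimensional subspaces, then $$\mathrm{ri}(\mathrm{gph}\,F)=\big\{(x,y)\;\big|\;x\in\mathrm{ri}(\mathrm{dom}\,F),\ y\in\mathrm{ri}(F(x))\big\}.$$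
   Context: All vector spaces are real. $X^*$ is the topological dual of $X$ and $\langle x^*,x\rangle$ the value of $x^*\in X^*$ at $x\in X$. A multifunction $F\colon X\rightrightarrows Y$ assigns to each $x\in X$ a (possibly empty) subset $F(x)\subset Y$; $\mathrm{dom}\,F=\{x\in X\mid F(x)\neq\emptyset\}$ and $\mathrm{gph}\,F=\{(x,y)\in X\times Y\mid y\in F(x)\}$. $F$ is generalized polyhedral convex if $\mathrm{gph}\,F$ is a generalized polyhedral convex set in $X\times Y$, i.e. the intersection of a closed affine subspace with finitely many sets $\{w\mid\langle w^*,w\rangle\le\alpha\}$, $w^*\in (X\times Y)^*$, $\alpha\in\mathbb{R}$; any graph of the displayed form has this property. A continuous linear mapping $A\colon Y\to Z$ is closed under finite-codimensional subspaces if $A(Y_0)$ is closed in $Z$ for every closed linear subspace $Y_0\subset Y$ of finite codimension. For a subset $\Omega$ of a locally convex Hausdorff topological vector space, the relative interior is $\mathrm{ri}\,\Omega=\{a\in\Omega\mid\exists$ a neighborhood $V$ of the origin such that $(a+V)\cap\overline{\mathrm{aff}\,\Omega}\subset\Omega\}$, where $\overline{\mathrm{aff}\,\Omega}$ is the closure of the affine hull of $\Omega$. *)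

theory Defs
  imports "HOL-Analysis.Analysis"
begin

section \<open>Locally convex Hausdorff topological vector spaces\<close>

text \<open>The condition on \<open>V\<close> is \<^prop>\<open>convex V\<close> unfolded: \<^const>\<open>convex\<close> carries the sort
  \<^class>\<open>real_vector\<close> and so cannot occur in a class specification.\<close>

class lc_hausdorff_tvs = real_vector + topological_ab_group_add + t2_space +
  assumes tendsto_scaleR_nhds:
    "((\<lambda>p. fst p *\<^sub>R snd p) \<longlongrightarrow> c *\<^sub>R x) (nhds c \<times>\<^sub>F nhds x)"
  assumes convex_nhds_base_unfolded:
    "open U \<Longrightarrow> 0 \<in> U \<Longrightarrow> \<exists>V. open V \<and> 0 \<in> V \<and>
      (\<forall>x\<in>V. \<forall>y\<in>V. \<forall>u\<ge>0. \<forall>v\<ge>0. u + v = 1 \<longrightarrow> u *\<^sub>R x + v *\<^sub>R y \<in> V) \<and> V \<subseteq> U"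

lemma convex_nhds_base:
  fixes U :: "'a::lc_hausdorff_tvs set"
  shows "open U \<Longrightarrow> 0 \<in> U \<Longrightarrow> \<exists>V. open V \<and> 0 \<in> V \<and> convex V \<and> V \<subseteq> U"
  unfolding convex_def by (rule convex_nhds_base_unfolded)

instance real_normed_vector \<subseteq> lc_hausdorff_tvs
proof
  fix c :: real and x :: 'a
  show "((\<lambda>p. fst p *\<^sub>R snd p) \<longlongrightarrow> c *\<^sub>R x) (nhds c \<times>\<^sub>F nhds x)"
    by (intro tendsto_scaleR filterlim_fst filterlim_snd)
next
  fix U :: "'a set" assume "open U" "0 \<in> U"
  then obtain e where "e > 0" "ball 0 e \<subseteq> U"
    by (meson openE)
  then show "\<exists>V. open V \<and> 0 \<in> V \<and>
      (\<forall>x\<in>V. \<forall>y\<in>V. \<forall>u\<ge>0. \<forall>v\<ge>0. u + v = 1 \<longrightarrow> u *\<^sub>R x + v *\<^sub>R y \<in> V) \<and> V \<subseteq> U"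
    unfolding convex_def[symmetric] using \<open>e > 0\<close>
    by (intro exI[of _ "ball 0 e"]) auto
qed

instance prod :: (topological_monoid_add, topological_monoid_add) topological_monoid_add
proof
  fix a b :: "'a \<times> 'b"
  have "((\<lambda>p. (fst (fst p) + fst (snd p), snd (fst p) + snd (snd p)))
      \<longlongrightarrow> (fst a + fst b, snd a + snd b)) (nhds a \<times>\<^sub>F nhds b)"
    by (intro tendsto_intros filterlim_fst filterlim_snd)
  then show "((\<lambda>p. fst p + snd p) \<longlongrightarrow> a + b) (nhds a \<times>\<^sub>F nhds b)"
    by (simp add: plus_prod_def)
qed

instance prod :: (topological_group_add, topological_group_add) topological_group_add
proof
  fix a :: "'a \<times> 'b"
  have "((\<lambda>p. (- fst p, - snd p)) \<longlongrightarrow> (- fst a, - snd a)) (nhds a)"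
    by (intro tendsto_intros filterlim_ident)
  then show "(uminus \<longlongrightarrow> - a) (nhds a)"
    by (simp add: uminus_prod_def [abs_def])
qed

instance prod :: (topological_ab_group_add, topological_ab_group_add) topological_ab_group_add ..

instance prod :: (lc_hausdorff_tvs, lc_hausdorff_tvs) lc_hausdorff_tvs
proof
  fix c :: real and x :: "'a \<times> 'b"
  have A: "((\<lambda>p. (fst p, fst (snd p))) \<longlongrightarrow> (c, fst x)) (nhds c \<times>\<^sub>F nhds x)"
    and B: "((\<lambda>p. (fst p, snd (snd p))) \<longlongrightarrow> (c, snd x)) (nhds c \<times>\<^sub>F nhds x)"
    by (intro tendsto_intros filterlim_fst filterlim_snd)+
  have "((\<lambda>p. fst p *\<^sub>R fst (snd p)) \<longlongrightarrow> c *\<^sub>R fst x) (nhds c \<times>\<^sub>F nhds x)"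
    using filterlim_compose[OF tendsto_scaleR_nhds[of c "fst x", unfolded nhds_prod[symmetric]] A]
    by simp
  moreover have "((\<lambda>p. fst p *\<^sub>R snd (snd p)) \<longlongrightarrow> c *\<^sub>R snd x) (nhds c \<times>\<^sub>F nhds x)"
    using filterlim_compose[OF tendsto_scaleR_nhds[of c "snd x", unfolded nhds_prod[symmetric]] B]
    by simp
  ultimately have "((\<lambda>p. (fst p *\<^sub>R fst (snd p), fst p *\<^sub>R snd (snd p)))
      \<longlongrightarrow> (c *\<^sub>R fst x, c *\<^sub>R snd x)) (nhds c \<times>\<^sub>F nhds x)"
    by (rule tendsto_Pair)
  then show "((\<lambda>p. fst p *\<^sub>R snd p) \<longlongrightarrow> c *\<^sub>R x) (nhds c \<times>\<^sub>F nhds x)"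
    by (simp add: scaleR_prod_def)
next
  fix U :: "('a \<times> 'b) set" assume "open U" "0 \<in> U"
  then obtain A B where AB: "open A" "open B" "0 \<in> A \<times> B" "A \<times> B \<subseteq> U"
    by (rule open_prod_elim)
  obtain V where V: "open V" "0 \<in> V" "convex V" "V \<subseteq> A"
    using convex_nhds_base[of A] AB by (auto simp: zero_prod_def)
  obtain W where W: "open W" "0 \<in> W" "convex W" "W \<subseteq> B"
    using convex_nhds_base[of B] AB by (auto simp: zero_prod_def)
  show "\<exists>V. open V \<and> 0 \<in> V \<and>
      (\<forall>x\<in>V. \<forall>y\<in>V. \<forall>u\<ge>0. \<forall>v\<ge>0. u + v = 1 \<longrightarrow> u *\<^sub>R x + v *\<^sub>R y \<in> V) \<and> V \<subseteq> U"
    unfolding convex_def[symmetric] using V W AB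
    by (intro exI[of _ "V \<times> W"]) (auto simp: zero_prod_def open_Times convex_Times)
qed

definition topological_dual :: "('a::lc_hausdorff_tvs \<Rightarrow> real) set" where
  "topological_dual = {f. linear f \<and> continuous_on UNIV f}"

section \<open>Relative interior\<close>

text \<open>Unlike \<^const>\<open>rel_interior\<close>, this notion is relative to the \<^emph>\<open>closed\<close> affine hull;
  the two differ in infinite dimension.\<close>

definition ri :: "'a::lc_hausdorff_tvs set \<Rightarrow> 'a set" where
  "ri \<Omega> = {a \<in> \<Omega>. \<exists>V. 0 \<in> interior V \<and> (+) a ` V \<inter> closure (affine hull \<Omega>) \<subseteq> \<Omega>}"

section \<open>Generalized polyhedral convex sets and multifunctions\<close>

definition gen_polyhedral_convex :: "'a::lc_hausdorff_tvs set \<Rightarrow> bool" where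
  "gen_polyhedral_convex C \<longleftrightarrow>
    (\<exists>L (n::nat) w \<alpha>. affine L \<and> closed L \<and> (\<forall>i\<in>{1..n}. w i \<in> topological_dual) \<and>
      C = L \<inter> {u. \<forall>i\<in>{1..n}. w i u \<le> \<alpha> i})"

definition mf_dom :: "('a \<Rightarrow> 'b set) \<Rightarrow> 'a set" where
  "mf_dom F = {x. F x \<noteq> {}}"

definition mf_gph :: "('a \<Rightarrow> 'b set) \<Rightarrow> ('a \<times> 'b) set" where
  "mf_gph F = {(x, y). y \<in> F x}"

definition gen_polyhedral_convex_mf ::
    "('a::lc_hausdorff_tvs \<Rightarrow> 'b::lc_hausdorff_tvs set) \<Rightarrow> bool" where
  "gen_polyhedral_convex_mf F \<longleftrightarrow> gen_polyhedral_convex (mf_gph F)"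

section \<open>Closedness under finite-codimensional subspaces\<close>

text \<open>Finite codimension is expressed by a finite-dimensional algebraic complement \<open>span B\<close>.\<close>

definition finite_codim :: "'a::real_vector set \<Rightarrow> bool" where
  "finite_codim S \<longleftrightarrow>
    (\<exists>B. finite B \<and> S \<inter> span B = {0} \<and> (\<forall>v. \<exists>s\<in>S. \<exists>b\<in>span B. v = s + b))"

definition closed_under_finite_codim ::
    "('a::lc_hausdorff_tvs \<Rightarrow> 'b::lc_hausdorff_tvs) \<Rightarrow> bool" where
  "closed_under_finite_codim A \<longleftrightarrow>
    (\<forall>S. subspace S \<and> closed S \<and> finite_codim S \<longrightarrow> closed (A ` S))"

text \<open>A graph given by a continuous linear equation and finitely many continuous linear
  inequalities is generalized polyhedral convex.\<close>

lemma gen_polyhedral_convex_system: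
  fixes A1 :: "'x::lc_hausdorff_tvs \<Rightarrow> 'z::lc_hausdorff_tvs"
    and A2 :: "'y::lc_hausdorff_tvs \<Rightarrow> 'z"
  assumes A1: "linear A1" "continuous_on UNIV A1"
    and A2: "linear A2" "continuous_on UNIV A2"
    and xs: "\<And>i. i \<in> {1..m::nat} \<Longrightarrow> xs i \<in> topological_dual"
    and ys: "\<And>i. i \<in> {1..m} \<Longrightarrow> ys i \<in> topological_dual"
  shows "gen_polyhedral_convex
    {(x, y). A1 x + A2 y = z \<and> (\<forall>i\<in>{1..m}. xs i x + ys i y \<le> \<beta> i)}"
proof -
  define L where "L = {p. A1 (fst p) + A2 (snd p) = z}"
  define w where "w = (\<lambda>i p. xs i (fst p) + ys i (snd p))"
  have contA: "continuous_on UNIV (\<lambda>p. A1 (fst p) + A2 (snd p))"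
    by (intro continuous_on_add continuous_on_compose2[OF A1(2)] continuous_on_compose2[OF A2(2)]
        continuous_on_fst continuous_on_snd continuous_on_id) auto
  have "closed L"
    unfolding L_def by (intro closed_Collect_eq contA continuous_on_const)
  moreover have "affine L"
  proof -
    have "A1 (u *\<^sub>R a + v *\<^sub>R c) + A2 (u *\<^sub>R b + v *\<^sub>R d) = z"
      if "A1 a + A2 b = z" "A1 c + A2 d = z" "u + v = 1" for a b c d u v
    proof -
      have "A1 (u *\<^sub>R a + v *\<^sub>R c) + A2 (u *\<^sub>R b + v *\<^sub>R d)
          = u *\<^sub>R (A1 a + A2 b) + v *\<^sub>R (A1 c + A2 d)"
        by (simp add: linear_add[OF A1(1)] linear_add[OF A2(1)] linear_scale[OF A1(1)]
            linear_scale[OF A2(1)] algebra_simps)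
      also have "\<dots> = (u + v) *\<^sub>R z"
        by (simp only: that(1,2) scaleR_left_distrib)
      finally show ?thesis using that by simp
    qed
    then show ?thesis unfolding affine_def L_def by auto
  qed
  moreover have "w i \<in> topological_dual" if "i \<in> {1..m}" for i
  proof -
    have X: "linear (xs i)" "continuous_on UNIV (xs i)" and Y: "linear (ys i)" "continuous_on UNIV (ys i)"
      using xs[OF that] ys[OF that] by (auto simp: topological_dual_def)
    have "continuous_on UNIV (w i)"
      unfolding w_def
      by (intro continuous_on_add continuous_on_compose2[OF X(2)] continuous_on_compose2[OF Y(2)]
          continuous_on_fst continuous_on_snd continuous_on_id) auto
    moreover have "linear (w i)"
      unfolding w_def
      by (rule linearI) (simp_all add: linear_add[OF X(1)] linear_add[OF Y(1)]
          linear_scale[OF X(1)] linear_scale[OF Y(1)] algebra_simps)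
    ultimately show ?thesis by (simp add: topological_dual_def)
  qed
  moreover have "{(x, y). A1 x + A2 y = z \<and> (\<forall>i\<in>{1..m}. xs i x + ys i y \<le> \<beta> i)}
      = L \<inter> {u. \<forall>i\<in>{1..m}. w i u \<le> \<beta> i}"
    by (auto simp: L_def w_def)
  ultimately show ?thesis
    unfolding gen_polyhedral_convex_def by blast
qed

end

theory Submission
  imports Defs
begin

text \<open>
  The closed affine hull makes \<^const>\<open>ri\<close> a topological notion, but on the sets at hand it agrees
  with a purely algebraic one: \<open>a\<close> lies in the intrinsic core of \<open>C\<close> if every segment from a point
  \<open>c \<in> C\<close> to \<open>a\<close> can be prolonged a little beyond \<open>a\<close> inside \<open>C\<close>. The inclusion of \<^const>\<open>ri\<close> in the
  intrinsic core holds for every set (lemma \<open>ri_subset_intrinsic_core\<close>). Conversely, a constraint of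
  a generalized polyhedral convex set that is tight at an intrinsic core point is tight on the whole
  set, so it cuts out a closed affine set, while the finitely many slack constraints persist
  near the point (lemma \<open>intrinsic_core_subset_ri\<close>).

  For convex graphs the formula of the theorem is elementary with intrinsic cores instead of
  relative interiors. The graph and the values \<open>F x\<close> are generalized polyhedral convex, hence
  everything reduces to one implication: if \<open>(x0, y0)\<close> is in the intrinsic core of the graph, then
  \<open>x0 \<in> ri (mf_dom F)\<close> (lemma \<open>intrinsic_core_graph_domain\<close>). The domain is a projection, and
  projections of closed affine sets need not be closed; this is where the assumption on \<open>A2\<close> enters.

  Let \<open>Q\<close> be the space of pairs \<open>(h, k)\<close> that keep the equation and all constraints tight at
  \<open>(x0, y0)\<close> unchanged. One needs that \<open>fst ` Q\<close> is closed and that a small \<open>h \<in> fst ` Q\<close> has a partner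
  \<open>k\<close> on which all functionals \<open>ys i\<close> are small, for then \<open>(x0 + h, y0 + k)\<close> still satisfies the slack
  constraints. Both follow from lemma \<open>projected_linear_system\<close>: the directions \<open>h\<close> having a partner \<open>k\<close>
  in the common kernel \<open>Y0\<close> of the \<open>ys i\<close> form a subspace \<open>K\<close>, which is closed because \<open>A2 ` Y0\<close> is
  closed, and \<open>fst ` Q\<close> exceeds \<open>K\<close> only by finitely many dimensions. In a Hausdorff space such an
  extension of a closed subspace is closed, and coordinates along the added vectors tend to \<open>0\<close>
  with the vector (lemma \<open>closed_finite_extension\<close>).
\<close>

section \<open>The intrinsic core\<close>

definition intrinsic_core :: "'a::real_vector set \<Rightarrow> 'a set" where
  "intrinsic_core C = {a \<in> C. \<forall>c\<in>C. \<exists>t>0. a + t *\<^sub>R (a - c) \<in> C}"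

lemma tendsto_scaleR_tvs:
  fixes g :: "'b \<Rightarrow> 'a::lc_hausdorff_tvs"
  assumes "(f \<longlongrightarrow> c) T" "(g \<longlongrightarrow> x) T"
  shows "((\<lambda>u. f u *\<^sub>R g u) \<longlongrightarrow> c *\<^sub>R x) T"
  using filterlim_compose[OF tendsto_scaleR_nhds[of c x, unfolded nhds_prod[symmetric]]
      tendsto_Pair[OF assms]]
  by simp

lemma open_absorbing:
  fixes W :: "'a::lc_hausdorff_tvs set"
  assumes "open W" "0 \<in> W"
  obtains t :: real where "t > 0" "t *\<^sub>R v \<in> W"
proof -
  have "((\<lambda>t. t *\<^sub>R v) \<longlongrightarrow> 0 *\<^sub>R v) (at_right (0::real))"
    by (intro tendsto_scaleR_tvs tendsto_ident_at tendsto_const)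
  then have "\<forall>\<^sub>F t in at_right (0::real). t *\<^sub>R v \<in> W"
    using assms by (intro topological_tendstoD) auto
  then have "\<forall>\<^sub>F t in at_right (0::real). t *\<^sub>R v \<in> W \<and> t > 0"
    using eventually_at_right_less by (rule eventually_conj)
  then show thesis
    using eventually_happens'[of "at_right (0::real)"] that by fastforce
qed

text \<open>The prolongation of a segment stays in the affine hull, and near \<open>a\<close> this hull is inside \<open>\<Omega>\<close>.\<close>

lemma ri_subset_intrinsic_core:
  fixes \<Omega> :: "'a::lc_hausdorff_tvs set"
  shows "ri \<Omega> \<subseteq> intrinsic_core \<Omega>"
proof
  fix a assume "a \<in> ri \<Omega>"
  then obtain V where a: "a \<in> \<Omega>" and V: "0 \<in> interior V"
    "(+) a ` V \<inter> closure (affine hull \<Omega>) \<subseteq> \<Omega>"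
    unfolding ri_def by blast
  have "\<exists>t>0. a + t *\<^sub>R (a - c) \<in> \<Omega>" if "c \<in> \<Omega>" for c
  proof -
    obtain t where t: "t > 0" "t *\<^sub>R (a - c) \<in> interior V"
      using open_absorbing[OF open_interior V(1)] .
    have "(1 + t) *\<^sub>R a + (- t) *\<^sub>R c \<in> affine hull \<Omega>"
      by (rule mem_affine[OF affine_affine_hull]) (use a that in \<open>auto simp: hull_inc\<close>)
    then have "a + t *\<^sub>R (a - c) \<in> closure (affine hull \<Omega>)"
      using closure_subset by (force simp: algebra_simps)
    moreover have "a + t *\<^sub>R (a - c) \<in> (+) a ` V"
      using t(2) interior_subset by blast
    ultimately show ?thesis using V(2) t(1) by blast
  qed
  with a show "a \<in> intrinsic_core \<Omega>" by (simp add: intrinsic_core_def)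
qed

text \<open>A linear functional whose maximum on \<open>C\<close> is attained at a core point is constant on \<open>C\<close>: otherwise it would increase
  when a segment from a point of smaller value is prolonged. This shows that tight constraints are
  implicit equations.\<close>

lemma intrinsic_core_maximum:
  assumes w: "linear (w :: 'a::real_vector \<Rightarrow> real)" and a: "a \<in> intrinsic_core C" and c: "c \<in> C"
    and le: "\<And>u. u \<in> C \<Longrightarrow> w u \<le> w a"
  shows "w c = w a"
proof -
  obtain t where t: "t > 0" "a + t *\<^sub>R (a - c) \<in> C"
    using a c by (auto simp: intrinsic_core_def)
  have "t * (w a - w c) \<le> 0"
    using le[OF t(2)] by (simp add: linear_add[OF w] linear_scale[OF w] linear_diff[OF w])
  then have "w a \<le> w c" using t(1) by (simp add: mult_le_0_iff)
  with le[OF c] show ?thesis by simp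
qed

text \<open>The closed affine hull lies in every closed affine superset \<open>E\<close>, so it is enough to find a
  neighborhood relative to \<open>E\<close>, and the hull itself never has to be computed.\<close>

lemma riI_affine:
  fixes \<Omega> :: "'a::lc_hausdorff_tvs set"
  assumes "a \<in> \<Omega>" "\<Omega> \<subseteq> E" "affine E" "closed E"
    and ev: "\<forall>\<^sub>F h in nhds 0. a + h \<in> E \<longrightarrow> a + h \<in> \<Omega>"
  shows "a \<in> ri \<Omega>"
proof -
  obtain V where V: "open V" "0 \<in> V" "\<And>h. h \<in> V \<Longrightarrow> a + h \<in> E \<Longrightarrow> a + h \<in> \<Omega>"
    using ev unfolding eventually_nhds by blast
  have "closure (affine hull \<Omega>) \<subseteq> E"
    using assms by (intro closure_minimal hull_minimal) auto
  then show ?thesis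
    unfolding ri_def using V assms(1) by (auto intro!: exI[of _ V] simp: interior_open)
qed

lemma dual_small:
  assumes "f \<in> topological_dual" "\<epsilon> > 0"
  shows "\<forall>\<^sub>F h in nhds 0. f h < \<epsilon>"
proof -
  have f: "linear f" "continuous_on UNIV f" using assms by (auto simp: topological_dual_def)
  have "(f \<longlongrightarrow> f 0) (nhds 0)"
    using f(2) by (simp add: continuous_on_eq_continuous_at isCont_def tendsto_at_iff_tendsto_nhds)
  then show ?thesis using assms(2) by (intro order_tendstoD) (auto simp: linear_0[OF f(1)])
qed

text \<open>Here the closed affine superset \<open>E\<close> comes from turning the tight constraints into equations.\<close>

lemma intrinsic_core_subset_ri:
  fixes C :: "'a::lc_hausdorff_tvs set"
  assumes "gen_polyhedral_convex C"
  shows "intrinsic_core C \<subseteq> ri C"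
proof
  fix a assume a: "a \<in> intrinsic_core C"
  obtain L n w \<alpha> where L: "affine L" "closed L" and w: "\<And>i. i \<in> {1..n::nat} \<Longrightarrow> w i \<in> topological_dual"
    and C: "C = L \<inter> {u. \<forall>i\<in>{1..n}. w i u \<le> \<alpha> i}"
    using assms unfolding gen_polyhedral_convex_def by blast
  have lin: "linear (w i)" "continuous_on UNIV (w i)" if "i \<in> {1..n}" for i
    using w[OF that] by (auto simp: topological_dual_def)
  have aC: "a \<in> C" using a by (simp add: intrinsic_core_def)
  define J where "J = {i \<in> {1..n}. w i a = \<alpha> i}"
  define E where "E = L \<inter> (\<Inter>i\<in>J. {u. w i u = \<alpha> i})"
  show "a \<in> ri C"
  proof (rule riI_affine[of a C E])
    show "a \<in> C" by (rule aC)
    have "w i c = \<alpha> i" if "c \<in> C" "i \<in> J" for c i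
      using intrinsic_core_maximum[of "w i" a C c] a that lin[of i] by (auto simp: J_def C)
    then show "C \<subseteq> E" using C by (auto simp: E_def)
    have "affine {u. w i u = \<alpha> i}" if "i \<in> J" for i
      using that lin[of i]
      by (auto simp: J_def affine_def linear_add linear_scale distrib_right[symmetric])
    then show "affine E" unfolding E_def using L by (intro affine_Int affine_Inter) auto
    show "closed E" unfolding E_def
      using L lin by (auto intro!: closed_Int closed_INT closed_Collect_eq continuous_on_const simp: J_def)
    have "\<forall>\<^sub>F h in nhds 0. i \<notin> J \<longrightarrow> w i h < \<alpha> i - w i a" if "i \<in> {1..n}" for i
    proof (cases "i \<in> J")
      case False
      then have "0 < \<alpha> i - w i a" using aC that by (force simp: C J_def)
      from dual_small[OF w[OF that] this] show ?thesis by (rule eventually_mono) simp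
    qed simp
    then have "\<forall>\<^sub>F h in nhds 0. \<forall>i\<in>{1..n}. i \<notin> J \<longrightarrow> w i h < \<alpha> i - w i a"
      by (intro eventually_ball_finite) auto
    then show "\<forall>\<^sub>F h in nhds 0. a + h \<in> E \<longrightarrow> a + h \<in> C"
    proof (rule eventually_mono, intro impI)
      fix h assume h: "\<forall>i\<in>{1..n}. i \<notin> J \<longrightarrow> w i h < \<alpha> i - w i a" "a + h \<in> E"
      have "w i (a + h) \<le> \<alpha> i" if "i \<in> {1..n}" for i
      proof (cases "i \<in> J")
        case True then show ?thesis using h(2) by (auto simp: E_def)
      next
        case False then show ?thesis using h(1) that lin(1)[OF that] by (force simp: linear_add)
      qed
      then show "a + h \<in> C" using h(2) by (auto simp: C E_def)
    qed
  qed
qed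

lemma gen_polyhedral_convex_imp_convex:
  assumes "gen_polyhedral_convex C"
  shows "convex C"
proof -
  obtain L n w \<alpha> where L: "affine L" and w: "\<And>i. i \<in> {1..n::nat} \<Longrightarrow> w i \<in> topological_dual"
    and C: "C = L \<inter> {u. \<forall>i\<in>{1..n}. w i u \<le> \<alpha> i}"
    using assms unfolding gen_polyhedral_convex_def by blast
  have "convex {u. w i u \<le> \<alpha> i}" if "i \<in> {1..n}" for i
  proof -
    have "linear (w i)" using w[OF that] by (simp add: topological_dual_def)
    then have "convex (w i -` {..\<alpha> i})" by (intro convex_linear_vimage convex_real_interval)
    then show ?thesis by (simp add: vimage_def)
  qed
  then have "convex (L \<inter> (\<Inter>i\<in>{1..n}. {u. w i u \<le> \<alpha> i}))"
    using L by (intro convex_Int convex_INT) (auto intro: affine_imp_convex)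
  moreover have "C = L \<inter> (\<Inter>i\<in>{1..n}. {u. w i u \<le> \<alpha> i})" by (auto simp: C)
  ultimately show ?thesis by simp
qed

lemma intrinsic_core_graph_fiber:
  assumes "(x, y) \<in> intrinsic_core (mf_gph F)"
  shows "y \<in> intrinsic_core (F x)"
proof -
  have "\<exists>t>0. y + t *\<^sub>R (y - y') \<in> F x" if "y' \<in> F x" for y'
  proof -
    have "(x, y') \<in> mf_gph F" using that by (simp add: mf_gph_def)
    then show ?thesis using assms by (fastforce simp: intrinsic_core_def mf_gph_def)
  qed
  then show ?thesis using assms by (auto simp: intrinsic_core_def mf_gph_def)
qed

text \<open>Given \<open>p = (x', y')\<close> in the graph, prolong from \<open>x'\<close> beyond \<open>x\<close> in the domain, and lift the end
  point to the graph. The segment from \<open>p\<close> to the lifted point meets the fiber over \<open>x\<close> in some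
  \<open>(x, yb)\<close>; prolong from \<open>yb\<close> beyond \<open>y\<close> in that fiber. Now \<open>(x, y)\<close> is a convex combination, with
  positive weights, of \<open>p\<close> and two other points of the graph, and the combination of just those two
  is the wanted prolongation of the segment from \<open>p\<close> to \<open>(x, y)\<close>.\<close>

lemma intrinsic_core_graphI:
  assumes conv: "convex (mf_gph F)"
    and x: "x \<in> intrinsic_core (mf_dom F)" and y: "y \<in> intrinsic_core (F x)"
  shows "(x, y) \<in> intrinsic_core (mf_gph F)"
proof -
  let ?G = "mf_gph F"
  have "\<exists>t>0. (x, y) + t *\<^sub>R ((x, y) - p) \<in> ?G" if p: "p \<in> ?G" for p
  proof -
    obtain x' y' where p': "p = (x', y')" by (cases p)
    have "x' \<in> mf_dom F" using p p' by (auto simp: mf_gph_def mf_dom_def)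
    then obtain t where t: "t > 0" "x + t *\<^sub>R (x - x') \<in> mf_dom F"
      using x by (auto simp: intrinsic_core_def)
    then obtain y2 where q: "(x + t *\<^sub>R (x - x'), y2) \<in> ?G"
      by (auto simp: mf_gph_def mf_dom_def)
    (* the weight of p at which the first coordinate returns to x *)
    define l where "l = t / (1 + t)"
    define yb where "yb = (1 - l) *\<^sub>R y2 + l *\<^sub>R y'"
    have l: "0 < l" "l < 1" using t by (auto simp: l_def)
    have lt: "(1 - l) * t = l" using t by (simp add: l_def field_simps)
    have "(1 - l) *\<^sub>R (x + t *\<^sub>R (x - x'), y2) + l *\<^sub>R p \<in> ?G"
      using conv q p l by (intro convexD) auto
    moreover have "(1 - l) *\<^sub>R (x + t *\<^sub>R (x - x')) + l *\<^sub>R x' = x"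
    proof -
      have "(1 - l) *\<^sub>R (x + t *\<^sub>R (x - x')) + l *\<^sub>R x'
          = (1 - l) *\<^sub>R x + ((1 - l) * t) *\<^sub>R (x - x') + l *\<^sub>R x'"
        by (simp add: scaleR_add_right)
      then show ?thesis unfolding lt by (simp add: algebra_simps)
    qed
    ultimately have "yb \<in> F x" by (simp add: p' yb_def mf_gph_def)
    then obtain s where s: "s > 0" "y + s *\<^sub>R (y - yb) \<in> F x"
      using y by (auto simp: intrinsic_core_def)
    (* Eliminating yb from (1 + s) y = (y + s (y - yb)) + s yb and removing the share s * l of p
       leaves the total weight d for the two other points. *)
    define d where "d = 1 + s * (1 - l)"
    define r where "r = s * l / d"
    have d: "d > 1" using s l by (simp add: d_def)
    have r: "r > 0" using s l d by (simp add: r_def)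
    have "(1 / d) *\<^sub>R (x, y + s *\<^sub>R (y - yb)) + (s * (1 - l) / d) *\<^sub>R (x + t *\<^sub>R (x - x'), y2) \<in> ?G"
    proof (rule convexD[OF conv])
      show "1 / d + s * (1 - l) / d = 1" using d by (simp add: d_def add_divide_distrib[symmetric])
    qed (use s q d l in \<open>auto simp: mf_gph_def\<close>)
    also have "(1 / d) *\<^sub>R (x, y + s *\<^sub>R (y - yb)) + (s * (1 - l) / d) *\<^sub>R (x + t *\<^sub>R (x - x'), y2)
      = (x, y) + r *\<^sub>R ((x, y) - p)"
    proof -
      have A: "1 / d + s * (1 - l) / d = 1" using d by (simp add: d_def add_divide_distrib[symmetric])
      have B: "(s * (1 - l) / d) * t = r" using lt by (simp add: r_def mult.assoc)
      have D: "1 / d * (1 + s) = 1 + r" using d by (simp add: r_def d_def field_simps)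
      have "(1 / d) *\<^sub>R x + (s * (1 - l) / d) *\<^sub>R (x + t *\<^sub>R (x - x'))
          = (1 / d + s * (1 - l) / d) *\<^sub>R x + ((s * (1 - l) / d) * t) *\<^sub>R (x - x')"
        by (simp add: algebra_simps)
      also have "\<dots> = x + r *\<^sub>R (x - x')" unfolding A B by simp
      finally have 1: "(1 / d) *\<^sub>R x + (s * (1 - l) / d) *\<^sub>R (x + t *\<^sub>R (x - x')) = x + r *\<^sub>R (x - x')" .
      have "(1 / d) *\<^sub>R (y + s *\<^sub>R (y - yb)) + (s * (1 - l) / d) *\<^sub>R y2
          = (1 / d * (1 + s)) *\<^sub>R y - (s * l / d) *\<^sub>R y'"
        by (simp add: yb_def algebra_simps diff_divide_distrib add_divide_distrib)
      also have "\<dots> = y + r *\<^sub>R (y - y')" unfolding D by (simp add: r_def algebra_simps)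
      finally show ?thesis using 1 by (simp add: p')
    qed
    finally show ?thesis using r by blast
  qed
  moreover have "(x, y) \<in> ?G" using y by (simp add: intrinsic_core_def mf_gph_def)
  ultimately show ?thesis by (simp add: intrinsic_core_def)
qed

section \<open>Finite-dimensional extensions of closed subspaces\<close>

text \<open>As \<open>N\<close> is closed, \<open>b - N\<close> misses a neighborhood of \<open>0\<close>. Hence its multiples \<open>c (b - N) = c b + N\<close>
  with \<open>\<bar>c\<bar> \<ge> \<epsilon>\<close> miss a common neighborhood of \<open>0\<close>.\<close>

lemma coordinate_small:
  fixes N :: "'a::lc_hausdorff_tvs set"
  assumes N: "subspace N" "closed N" and b: "b \<notin> N" and e: "\<epsilon> > 0"
  shows "\<forall>\<^sub>F v in nhds 0. \<forall>c. v - c *\<^sub>R b \<in> N \<longrightarrow> \<bar>c\<bar> < \<epsilon>"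
proof -
  have "((\<lambda>p. b - fst p *\<^sub>R snd p) \<longlongrightarrow> b - 0 *\<^sub>R 0) (nhds (0::real) \<times>\<^sub>F nhds (0::'a))"
    by (intro tendsto_diff tendsto_const tendsto_scaleR_nhds)
  then have "\<forall>\<^sub>F p in nhds (0::real) \<times>\<^sub>F nhds (0::'a). b - fst p *\<^sub>R snd p \<in> - N"
    using N(2) b by (intro topological_tendstoD) auto
  then obtain P Q where PQ: "eventually P (nhds (0::real))" "eventually Q (nhds (0::'a))"
    "\<And>t w. P t \<Longrightarrow> Q w \<Longrightarrow> b - t *\<^sub>R w \<notin> N"
    unfolding eventually_prod_filter by auto
  obtain d where d: "d > 0" "\<And>t. \<bar>t\<bar> < d \<Longrightarrow> P t"
    using PQ(1) unfolding eventually_nhds_metric by (auto simp: dist_real_def)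
  (* With w = k v and t = 1 / (k c), the bound \<bar>c\<bar> \<ge> \<epsilon> gives \<bar>t\<bar> \<le> d / 2 < d. *)
  define k where "k = 2 / (d * \<epsilon>)"
  have k: "k > 0" using d e by (simp add: k_def)
  have "((\<lambda>v::'a. k *\<^sub>R v) \<longlongrightarrow> k *\<^sub>R 0) (nhds 0)"
    by (intro tendsto_scaleR_tvs tendsto_const filterlim_ident)
  then have "\<forall>\<^sub>F v in nhds (0::'a). Q (k *\<^sub>R v)"
    using PQ(2) by (auto dest: eventually_compose_filterlim)
  then show ?thesis
  proof (elim eventually_mono, intro allI impI)
    fix v c assume v: "Q (k *\<^sub>R v)" "v - c *\<^sub>R b \<in> N"
    show "\<bar>c\<bar> < \<epsilon>"
    proof (rule ccontr)
      assume "\<not> \<bar>c\<bar> < \<epsilon>"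
      then have c: "\<bar>c\<bar> \<ge> \<epsilon>" "c \<noteq> 0" using e by auto
      have "\<bar>1 / (k * c)\<bar> < d"
      proof -
        have "d * \<epsilon> \<le> d * \<bar>c\<bar>" using c d by simp
        moreover have "0 < d * \<bar>c\<bar>" using c d by simp
        ultimately have "d * \<epsilon> < 2 * (d * \<bar>c\<bar>)" by linarith
        then show ?thesis using c d e by (simp add: k_def abs_mult field_simps)
      qed
      from PQ(3)[OF d(2)[OF this] v(1)] have "b - (1 / c) *\<^sub>R v \<notin> N" using k by simp
      moreover have "(- 1 / c) *\<^sub>R (v - c *\<^sub>R b) \<in> N" using N(1) v(2) by (rule subspace_scale)
      moreover have "(- 1 / c) *\<^sub>R (v - c *\<^sub>R b) = b - (1 / c) *\<^sub>R v"
        using c by (simp add: algebra_simps)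
      ultimately show False by simp
    qed
  qed
qed

text \<open>Near a given vector only a bounded range of coordinates \<open>c\<close> can occur, so it is enough to avoid
  \<open>N + c b\<close> for \<open>c\<close> in a compact interval, which the tube lemma makes possible on a whole neighborhood.\<close>

lemma closed_span_insert:
  fixes N :: "'a::lc_hausdorff_tvs set"
  assumes N: "subspace N" "closed N"
  shows "closed (span (insert b N))"
proof (cases "b \<in> N")
  case True
  then show ?thesis using N by (simp add: insert_absorb span_eq_iff[THEN iffD2])
next
  case False
  have sp: "span (insert b N) = {v. \<exists>c. v - c *\<^sub>R b \<in> N}"
    using N(1) by (simp add: span_insert span_eq_iff[THEN iffD2])
  have "\<exists>T. open T \<and> v \<in> T \<and> T \<subseteq> - span (insert b N)" if v: "v \<notin> span (insert b N)" for v
  proof -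
    obtain W where W: "open W" "0 \<in> W" "\<And>u c. u \<in> W \<Longrightarrow> u - c *\<^sub>R b \<in> N \<Longrightarrow> \<bar>c\<bar> < 1"
      using coordinate_small[OF N False, of 1] unfolding eventually_nhds by auto
    obtain s where s: "s > 0" "s *\<^sub>R v \<in> W"
      using open_absorbing[OF W(1,2)] .
    have cont: "continuous_on UNIV (\<lambda>u::'a. s *\<^sub>R u)"
      unfolding continuous_on_def by (intro ballI tendsto_scaleR_tvs tendsto_const tendsto_ident_at)
    have cont2: "continuous_on UNIV (\<lambda>p::'a \<times> real. fst p - snd p *\<^sub>R b)"
      unfolding continuous_on_def
      by (intro ballI tendsto_diff tendsto_scaleR_tvs tendsto_const tendsto_fst tendsto_snd tendsto_ident_at)
    define D where "D = (\<lambda>p::'a \<times> real. fst p - snd p *\<^sub>R b) -` (- N)"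
    have "open D" unfolding D_def using N(2) cont2 by (intro open_vimage) auto
    moreover have "{v} \<times> {-1/s..1/s} \<subseteq> D" using v by (auto simp: D_def sp)
    ultimately obtain X0 where X0: "v \<in> X0" "open X0" "X0 \<times> {-1/s..1/s} \<subseteq> D"
      using Elementary_Topology.tube_lemma[of "{-1/s..1/s}" D v] by auto
    define T where "T = X0 \<inter> (\<lambda>u. s *\<^sub>R u) -` W"
    have "open T" unfolding T_def using X0 W cont by (intro open_Int open_vimage) auto
    moreover have "v \<in> T" using X0 s by (simp add: T_def)
    moreover have "T \<subseteq> - span (insert b N)"
    proof
      fix u assume u: "u \<in> T"
      have "u - c *\<^sub>R b \<notin> N" for c
      proof
        assume c: "u - c *\<^sub>R b \<in> N"
        then have "s *\<^sub>R (u - c *\<^sub>R b) \<in> N" using N(1) by (rule subspace_scale[rotated])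
        then have "s *\<^sub>R u - (s * c) *\<^sub>R b \<in> N" by (simp add: algebra_simps)
        then have "\<bar>s * c\<bar> < 1" using u W(3) by (auto simp: T_def)
        then have "c \<in> {-1/s..1/s}" using s(1) by (auto simp: abs_less_iff field_simps)
        then have "(u, c) \<in> D" using X0 u by (auto simp: T_def)
        with c show False by (simp add: D_def)
      qed
      then show "u \<in> - span (insert b N)" by (simp add: sp)
    qed
    ultimately show ?thesis by blast
  qed
  then have "open (- span (insert b N))" by (subst open_subopen) auto
  then show ?thesis by (simp add: closed_def)
qed

text \<open>The smallness part says that \<open>K \<times> \<real>\<^sup>B \<rightarrow> span (K \<union> B)\<close> is open at \<open>0\<close>. In this form, unlike one about
  coordinate functionals, it makes sense for linearly dependent \<open>B\<close>, so that images of arbitrary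
  finite sets may be used.\<close>

lemma closed_finite_extension:
  fixes K :: "'a::lc_hausdorff_tvs set"
  assumes K: "subspace K" "closed K" and B: "finite B"
  shows "closed (span (K \<union> B)) \<and> (\<forall>\<epsilon>>0. \<forall>\<^sub>F v in nhds 0. v \<in> span (K \<union> B) \<longrightarrow>
    (\<exists>c. (\<forall>b\<in>B. \<bar>c b\<bar> < \<epsilon>) \<and> v - (\<Sum>b\<in>B. c b *\<^sub>R b) \<in> K))"
  using B
proof (induction B)
  case empty
  then show ?case using K by (simp add: span_eq_iff[THEN iffD2])
next
  case (insert b B)
  let ?N = "span (K \<union> B)"
  from insert.IH have N: "closed ?N" and small: "\<And>\<epsilon>. \<epsilon> > 0 \<Longrightarrow> \<forall>\<^sub>F v in nhds 0. v \<in> ?N \<longrightarrow>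
    (\<exists>c. (\<forall>b\<in>B. \<bar>c b\<bar> < \<epsilon>) \<and> v - (\<Sum>b\<in>B. c b *\<^sub>R b) \<in> K)"
    by auto
  have sp: "span (K \<union> insert b B) = span (insert b ?N)"
    unfolding Un_insert_right span_insert span_span ..
  have "\<forall>\<^sub>F v in nhds 0. v \<in> span (K \<union> insert b B) \<longrightarrow>
      (\<exists>c. (\<forall>a\<in>insert b B. \<bar>c a\<bar> < \<epsilon>) \<and> v - (\<Sum>a\<in>insert b B. c a *\<^sub>R a) \<in> K)"
    if e: "\<epsilon> > 0" for \<epsilon> :: real
  proof (cases "b \<in> ?N")
    case True
    then have "span (K \<union> insert b B) = ?N" by (simp add: span_redundant)
    moreover note small[OF e]
    ultimately show ?thesis
    proof (simp only:, elim eventually_mono, intro impI)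
      fix v assume "v \<in> ?N \<longrightarrow> (\<exists>c. (\<forall>b\<in>B. \<bar>c b\<bar> < \<epsilon>) \<and> v - (\<Sum>b\<in>B. c b *\<^sub>R b) \<in> K)" "v \<in> ?N"
      then obtain c where c: "\<forall>b\<in>B. \<bar>c b\<bar> < \<epsilon>" "v - (\<Sum>b\<in>B. c b *\<^sub>R b) \<in> K" by blast
      have "(\<Sum>a\<in>B. (c(b := 0)) a *\<^sub>R a) = (\<Sum>a\<in>B. c a *\<^sub>R a)"
        using insert.hyps by (intro sum.cong) auto
      then show "\<exists>c. (\<forall>a\<in>insert b B. \<bar>c a\<bar> < \<epsilon>) \<and> v - (\<Sum>a\<in>insert b B. c a *\<^sub>R a) \<in> K"
        using c e insert.hyps by (intro exI[of _ "c(b := 0)"]) auto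
    qed
  next
    case False
    obtain W where W: "open W" "0 \<in> W" "\<forall>v\<in>W. v \<in> ?N \<longrightarrow>
        (\<exists>c. (\<forall>b\<in>B. \<bar>c b\<bar> < \<epsilon>) \<and> v - (\<Sum>b\<in>B. c b *\<^sub>R b) \<in> K)"
      using small[OF e] unfolding eventually_nhds by (elim exE conjE)
    have "((\<lambda>p. fst p - snd p *\<^sub>R b) \<longlongrightarrow> 0 - 0 *\<^sub>R b) (nhds (0::'a) \<times>\<^sub>F nhds (0::real))"
      by (intro tendsto_diff tendsto_scaleR_tvs tendsto_const filterlim_fst filterlim_snd)
    then have "\<forall>\<^sub>F p in nhds (0::'a) \<times>\<^sub>F nhds (0::real). fst p - snd p *\<^sub>R b \<in> W"
      using W by (intro topological_tendstoD) auto
    then obtain P Q where PQ: "eventually P (nhds (0::'a))" "eventually Q (nhds (0::real))"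
      "\<And>v t. P v \<Longrightarrow> Q t \<Longrightarrow> v - t *\<^sub>R b \<in> W"
      unfolding eventually_prod_filter by auto
    obtain d where d: "d > 0" "\<And>t. \<bar>t\<bar> < d \<Longrightarrow> Q t"
      using PQ(2) unfolding eventually_nhds_metric by (auto simp: dist_real_def)
    have "min d \<epsilon> > 0" using d e by simp
    then have "\<forall>\<^sub>F v in nhds 0. \<forall>c. v - c *\<^sub>R b \<in> ?N \<longrightarrow> \<bar>c\<bar> < min d \<epsilon>"
      using N False by (intro coordinate_small) auto
    with PQ(1) show ?thesis
    proof eventually_elim
      case (elim v)
      show ?case
      proof
        assume "v \<in> span (K \<union> insert b B)"
        then obtain t where t: "v - t *\<^sub>R b \<in> ?N" unfolding sp span_insert span_span by blast
        then have "\<bar>t\<bar> < min d \<epsilon>" using elim by blast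
        then have t': "\<bar>t\<bar> < \<epsilon>" "v - t *\<^sub>R b \<in> W" using d elim PQ(3) by auto
        obtain c where c: "\<forall>b\<in>B. \<bar>c b\<bar> < \<epsilon>" "v - t *\<^sub>R b - (\<Sum>b\<in>B. c b *\<^sub>R b) \<in> K"
          using bspec[OF W(3) t'(2)] t by blast
        have "(\<Sum>a\<in>B. (c(b := t)) a *\<^sub>R a) = (\<Sum>a\<in>B. c a *\<^sub>R a)"
          using insert.hyps by (intro sum.cong) auto
        then show "\<exists>c. (\<forall>a\<in>insert b B. \<bar>c a\<bar> < \<epsilon>) \<and> v - (\<Sum>a\<in>insert b B. c a *\<^sub>R a) \<in> K"
          using c t' insert.hyps by (intro exI[of _ "c(b := t)"]) (auto simp: diff_diff_eq)
      qed
    qed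
  qed
  moreover have "closed (span (K \<union> insert b B))"
    unfolding sp using N by (intro closed_span_insert) auto
  ultimately show ?case by blast
qed

section \<open>Projections of linear systems\<close>

text \<open>The span of \<open>B\<close> is a complement in \<open>Q\<close> of the common kernel of the \<open>\<phi> i\<close>: a new functional
  that does not vanish on the current kernel contributes one vector of this kernel to \<open>B\<close>.\<close>

lemma finite_transversal:
  fixes \<phi> :: "'i \<Rightarrow> 'a::real_vector \<Rightarrow> real"
  assumes Q: "subspace Q" and I: "finite I" and lin: "\<And>i. i \<in> I \<Longrightarrow> linear (\<phi> i)"
  shows "\<exists>B. finite B \<and> B \<subseteq> Q \<and> (\<forall>q\<in>Q. \<exists>s\<in>span B. \<forall>i\<in>I. \<phi> i (q - s) = 0)
    \<and> (\<forall>s\<in>span B. (\<forall>i\<in>I. \<phi> i s = 0) \<longrightarrow> s = 0)"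
  using I lin
proof (induction I)
  case empty
  then show ?case by (intro exI[of _ "{}"]) auto
next
  case (insert j I)
  then obtain B where B: "finite B" "B \<subseteq> Q" "\<And>q. q \<in> Q \<Longrightarrow> \<exists>s\<in>span B. \<forall>i\<in>I. \<phi> i (q - s) = 0"
    "\<And>s. s \<in> span B \<Longrightarrow> (\<And>i. i \<in> I \<Longrightarrow> \<phi> i s = 0) \<Longrightarrow> s = 0" by auto
  have lin: "linear (\<phi> i)" if "i \<in> insert j I" for i using insert.prems that by blast
  have spQ: "span B \<subseteq> Q" using B(2) Q by (simp add: span_minimal)
  show ?case
  proof (cases "\<forall>q\<in>Q. (\<forall>i\<in>I. \<phi> i q = 0) \<longrightarrow> \<phi> j q = 0")
    case True
    have "\<exists>s\<in>span B. \<forall>i\<in>insert j I. \<phi> i (q - s) = 0" if q: "q \<in> Q" for q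
    proof -
      obtain s where s: "s \<in> span B" "\<forall>i\<in>I. \<phi> i (q - s) = 0" using B(3)[OF q] by blast
      moreover have "q - s \<in> Q" using s spQ q Q by (auto intro: subspace_diff)
      ultimately show ?thesis using True by auto
    qed
    then show ?thesis using B by (intro exI[of _ B]) auto
  next
    case False
    then obtain b where b: "b \<in> Q" "\<forall>i\<in>I. \<phi> i b = 0" "\<phi> j b \<noteq> 0" by blast
    have "\<exists>s\<in>span (insert b B). \<forall>i\<in>insert j I. \<phi> i (q - s) = 0" if q: "q \<in> Q" for q
    proof -
      obtain s where s: "s \<in> span B" "\<forall>i\<in>I. \<phi> i (q - s) = 0" using B(3)[OF q] by blast
      define c where "c = \<phi> j (q - s) / \<phi> j b"
      have "s + c *\<^sub>R b \<in> span (insert b B)"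
        using s(1) by (meson insertI1 span_add span_base span_mono span_scale subsetD subset_insertI)
      moreover have "\<phi> i (q - (s + c *\<^sub>R b)) = 0" if "i \<in> insert j I" for i
      proof -
        have "\<phi> i (q - (s + c *\<^sub>R b)) = \<phi> i (q - s) - c * \<phi> i b"
          using lin[OF that] by (simp add: linear_diff linear_add linear_scale)
        then show ?thesis using s(2) b that by (auto simp: c_def)
      qed
      ultimately show ?thesis by blast
    qed
    moreover have "s = 0" if s: "s \<in> span (insert b B)" "\<forall>i\<in>insert j I. \<phi> i s = 0" for s
    proof -
      obtain c where c: "s - c *\<^sub>R b \<in> span B" using s(1) by (auto simp: span_insert)
      have eq: "\<phi> i (s - c *\<^sub>R b) = \<phi> i s - c * \<phi> i b" if "i \<in> insert j I" for i
        using lin[OF that] by (simp add: linear_diff linear_scale)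
      have "s - c *\<^sub>R b = 0" using B(4)[OF c] eq s(2) b by auto
      moreover from this have "c = 0"
        using eq[of j] s(2) b lin[of j] by (auto simp: linear_0)
      ultimately show ?thesis by simp
    qed
    ultimately show ?thesis using B(1,2) b(1) by (intro exI[of _ "insert b B"]) auto
  qed
qed

lemma common_kernel_finite_codim:
  fixes f :: "'i \<Rightarrow> 'a::lc_hausdorff_tvs \<Rightarrow> real"
  assumes I: "finite I" and f: "\<And>i. i \<in> I \<Longrightarrow> f i \<in> topological_dual"
  defines "S \<equiv> {v. \<forall>i\<in>I. f i v = 0}"
  shows "subspace S" "closed S" "finite_codim S"
proof -
  have lin: "linear (f i)" "continuous_on UNIV (f i)" if "i \<in> I" for i
    using f[OF that] by (auto simp: topological_dual_def)
  show "subspace S"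
    using lin by (auto simp: subspace_def S_def linear_0 linear_add linear_scale)
  have "S = (\<Inter>i\<in>I. {v. f i v = 0})" by (auto simp: S_def)
  then show "closed S" using lin by (auto intro!: closed_INT closed_Collect_eq continuous_on_const)
  obtain B where B: "finite B" "\<And>q. \<exists>s\<in>span B. \<forall>i\<in>I. f i (q - s) = 0"
    "\<And>s. s \<in> span B \<Longrightarrow> (\<forall>i\<in>I. f i s = 0) \<Longrightarrow> s = 0"
    using finite_transversal[of UNIV I f] I lin by auto
  have "\<exists>s\<in>S. \<exists>b\<in>span B. v = s + b" for v
  proof -
    obtain b where "b \<in> span B" "\<forall>i\<in>I. f i (v - b) = 0" using B(2)[of v] by blast
    then show ?thesis by (intro bexI[of _ "v - b"] bexI[of _ b]) (auto simp: S_def)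
  qed
  moreover have "S \<inter> span B = {0}"
    using B(3) \<open>subspace S\<close> by (auto simp: S_def span_zero linear_0[OF lin(1)])
  ultimately show "finite_codim S" using B(1) unfolding finite_codim_def by blast
qed

text \<open>The set \<open>I\<close> of functionals that have to be small on \<open>k\<close> may exceed the set \<open>J\<close> of those that
  enter the system: in the application, \<open>J\<close> indexes the tight constraints, but the slack ones have to
  be controlled as well.\<close>

lemma projected_linear_system:
  fixes A1 :: "'x::lc_hausdorff_tvs \<Rightarrow> 'z::lc_hausdorff_tvs"
    and A2 :: "'y::lc_hausdorff_tvs \<Rightarrow> 'z"
    and xs :: "'i \<Rightarrow> 'x \<Rightarrow> real" and ys :: "'i \<Rightarrow> 'y \<Rightarrow> real"
  assumes A1: "linear A1" "continuous_on UNIV A1"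
    and A2: "linear A2" "closed_under_finite_codim A2"
    and I: "finite I" "J \<subseteq> I"
    and xs: "\<And>i. i \<in> J \<Longrightarrow> xs i \<in> topological_dual"
    and ys: "\<And>i. i \<in> I \<Longrightarrow> ys i \<in> topological_dual"
  defines "Q \<equiv> {(h, k). A1 h + A2 k = 0 \<and> (\<forall>i\<in>J. xs i h + ys i k = 0)}"
  shows "subspace (fst ` Q)" "closed (fst ` Q)"
    and "\<epsilon> > 0 \<Longrightarrow> \<forall>\<^sub>F h in nhds 0. h \<in> fst ` Q \<longrightarrow> (\<exists>k. (h, k) \<in> Q \<and> (\<forall>i\<in>I. \<bar>ys i k\<bar> < \<epsilon>))"
proof -
  have X: "linear (xs i)" "continuous_on UNIV (xs i)" if "i \<in> J" for i
    using xs[OF that] by (auto simp: topological_dual_def)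
  have Y: "linear (ys i)" "continuous_on UNIV (ys i)" if "i \<in> I" for i
    using ys[OF that] by (auto simp: topological_dual_def)
  have YJ: "linear (ys i)" if "i \<in> J" for i using Y I that by auto
  let ?w = "\<lambda>i p. xs i (fst p) + ys i (snd p)"
  have linA: "linear (\<lambda>p. A1 (fst p) + A2 (snd p))"
    by (rule linearI) (simp_all add: linear_add[OF A1(1)] linear_add[OF A2(1)]
        linear_scale[OF A1(1)] linear_scale[OF A2(1)] algebra_simps)
  have linw: "linear (?w i)" if "i \<in> J" for i
    by (rule linearI) (simp_all add: linear_add[OF X(1)] linear_add[OF YJ]
        linear_scale[OF X(1)] linear_scale[OF YJ] that algebra_simps)
  have subQ: "subspace Q"
  proof -
    have "subspace ({p. A1 (fst p) + A2 (snd p) = 0} \<inter> (\<Inter>i\<in>J. {p. ?w i p = 0}))"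
      using linA linw by (intro subspace_Int subspace_inter) (auto intro: linear_subspace_kernel)
    also have "\<dots> = Q" by (auto simp: Q_def)
    finally show ?thesis .
  qed
  define Y0 where "Y0 = {k. \<forall>i\<in>I. ys i k = 0}"
  define K where "K = {h. A1 h \<in> A2 ` Y0 \<and> (\<forall>i\<in>J. xs i h = 0)}"
  have Y0: "subspace Y0" "closed Y0" "finite_codim Y0"
    unfolding Y0_def using I(1) ys by (auto intro!: common_kernel_finite_codim)
  have "subspace (fst ` Q)" using linear_fst subQ by (rule linear_subspace_image)
  show "subspace (fst ` Q)" by fact
  have A2Y0: "closed (A2 ` Y0)" "subspace (A2 ` Y0)"
    using A2 Y0 by (auto simp: closed_under_finite_codim_def intro: linear_subspace_image)
  have "K = A1 -` (A2 ` Y0) \<inter> (\<Inter>i\<in>J. {h. xs i h = 0})" by (auto simp: K_def)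
  then have clK: "closed K"
    using A1(2) A2Y0(1) X
    by (auto intro!: closed_Int closed_INT closed_Collect_eq continuous_on_const closed_vimage)
  have subK: "subspace K"
    using A2Y0(2) A1(1) X(1) unfolding subspace_def K_def
    by (auto simp: linear_0 linear_add linear_scale)
  have K_lift: "\<exists>k. (h, k) \<in> Q \<and> (\<forall>i\<in>I. ys i k = 0)" if "h \<in> K" for h
  proof -
    from that obtain k where k: "A1 h = A2 k" "k \<in> Y0" by (auto simp: K_def)
    have "- k \<in> Y0" using k(2) Y0(1) by (rule subspace_neg[rotated])
    then show ?thesis using k(1) that I(2)
      by (intro exI[of _ "- k"]) (auto simp: Q_def Y0_def K_def linear_neg[OF A2(1)])
  qed
  have lin_snd: "linear (\<lambda>p. ys i (snd p))" if "i \<in> I" for i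
    using linear_compose[OF linear_snd Y(1)[OF that]] by (simp add: o_def)
  have "\<exists>B. finite B \<and> B \<subseteq> Q \<and> (\<forall>q\<in>Q. \<exists>s\<in>span B. \<forall>i\<in>I. ys i (snd (q - s)) = 0)
      \<and> (\<forall>s\<in>span B. (\<forall>i\<in>I. ys i (snd s) = 0) \<longrightarrow> s = 0)"
    by (rule finite_transversal[OF subQ I(1) lin_snd])
  then obtain B where B: "finite B" "B \<subseteq> Q"
    "\<forall>q\<in>Q. \<exists>s\<in>span B. \<forall>i\<in>I. ys i (snd (q - s)) = 0"
    by (elim exE conjE)
  have spQ: "span B \<subseteq> Q" using B(2) subQ by (rule span_minimal)
  have decomposition: "fst ` Q = span (K \<union> fst ` B)"
  proof
    show "span (K \<union> fst ` B) \<subseteq> fst ` Q"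
      using K_lift B(2) \<open>subspace (fst ` Q)\<close> by (intro span_minimal) force+
    show "fst ` Q \<subseteq> span (K \<union> fst ` B)"
    proof
      fix h assume "h \<in> fst ` Q"
      then obtain q where q: "q \<in> Q" "h = fst q" by auto
      obtain s where s: "s \<in> span B" "\<forall>i\<in>I. ys i (snd (q - s)) = 0" using bspec[OF B(3) q(1)] by blast
      have qs: "q - s \<in> Q" using q s spQ subQ by (auto intro: subspace_diff)
      have "A1 (fst (q - s)) + A2 (snd (q - s)) = 0"
        using qs by (simp add: Q_def case_prod_beta del: fst_diff snd_diff)
      then have "A1 (fst (q - s)) = A2 (- snd (q - s))"
        by (simp only: linear_neg[OF A2(1)] eq_neg_iff_add_eq_0)
      moreover have "- snd (q - s) \<in> Y0"
        using s(2) Y0(1) by (intro subspace_neg) (auto simp: Y0_def)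
      moreover have "xs i (fst (q - s)) = 0" if "i \<in> J" for i
      proof -
        have "xs i (fst (q - s)) + ys i (snd (q - s)) = 0"
          using qs that by (simp add: Q_def case_prod_beta del: fst_diff snd_diff)
        moreover have "ys i (snd (q - s)) = 0" using s(2) that I(2) by blast
        ultimately show ?thesis by linarith
      qed
      ultimately have "fst (q - s) \<in> K" by (auto simp: K_def)
      then have "fst (q - s) \<in> span (K \<union> fst ` B)" by (intro span_base) auto
      moreover have "fst s \<in> span (fst ` B)"
        using s(1) linear_span_image[OF linear_fst, of B] by auto
      then have "fst s \<in> span (K \<union> fst ` B)" using span_mono[of "fst ` B" "K \<union> fst ` B"] by blast
      ultimately have "fst (q - s) + fst s \<in> span (K \<union> fst ` B)" by (rule span_add)
      then show "h \<in> span (K \<union> fst ` B)" using q by simp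
    qed
  qed
  note ext = closed_finite_extension[OF subK clK finite_imageI[OF B(1), of fst], folded decomposition]
  show "closed (fst ` Q)" using ext by blast
  assume e: "\<epsilon> > 0"
  (* Lift the vectors spanning the finite-dimensional part of h back to Q; M bounds the effect of
     their coefficients on all functionals at once. *)
  define l where "l = inv_into B fst"
  have l: "l b \<in> Q" "fst (l b) = b" if "b \<in> fst ` B" for b
    unfolding l_def using inv_into_into[OF that] f_inv_into_f[OF that] B(2) by blast+
  define M where "M = 1 + (\<Sum>i\<in>I. \<Sum>b\<in>fst ` B. \<bar>ys i (snd (l b))\<bar>)"
  have M: "M > 0" unfolding M_def by (intro add_pos_nonneg sum_nonneg) auto
  have "\<forall>\<^sub>F h in nhds 0. h \<in> fst ` Q \<longrightarrow>
      (\<exists>c. (\<forall>b\<in>fst ` B. \<bar>c b\<bar> < \<epsilon> / M) \<and> h - (\<Sum>b\<in>fst ` B. c b *\<^sub>R b) \<in> K)"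
    using ext e M by simp
  then show "\<forall>\<^sub>F h in nhds 0. h \<in> fst ` Q \<longrightarrow> (\<exists>k. (h, k) \<in> Q \<and> (\<forall>i\<in>I. \<bar>ys i k\<bar> < \<epsilon>))"
  proof (elim eventually_mono, intro impI)
    fix h
    assume "h \<in> fst ` Q \<longrightarrow>
      (\<exists>c. (\<forall>b\<in>fst ` B. \<bar>c b\<bar> < \<epsilon> / M) \<and> h - (\<Sum>b\<in>fst ` B. c b *\<^sub>R b) \<in> K)" "h \<in> fst ` Q"
    then obtain c where c: "\<And>b. b \<in> fst ` B \<Longrightarrow> \<bar>c b\<bar> < \<epsilon> / M"
      "h - (\<Sum>b\<in>fst ` B. c b *\<^sub>R b) \<in> K" by blast
    obtain k0 where k0: "(h - (\<Sum>b\<in>fst ` B. c b *\<^sub>R b), k0) \<in> Q" "\<forall>i\<in>I. ys i k0 = 0"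
      using K_lift[OF c(2)] by blast
    define p where "p = (h - (\<Sum>b\<in>fst ` B. c b *\<^sub>R b), k0) + (\<Sum>b\<in>fst ` B. c b *\<^sub>R l b)"
    have "p \<in> Q" unfolding p_def
      using k0(1) l(1) subQ by (intro subspace_add subspace_sum subspace_scale)
    moreover have "fst p = h" by (simp add: p_def fst_sum l(2))
    moreover have "\<bar>ys i (snd p)\<bar> < \<epsilon>" if i: "i \<in> I" for i
    proof -
      have "ys i (snd p) = (\<Sum>b\<in>fst ` B. c b * ys i (snd (l b)))"
        using k0(2) i Y(1)[OF i] by (simp add: p_def snd_sum linear_add linear_sum linear_scale)
      also have "\<bar>\<dots>\<bar> \<le> (\<Sum>b\<in>fst ` B. \<epsilon> / M * \<bar>ys i (snd (l b))\<bar>)"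
        by (intro order_trans[OF sum_abs] sum_mono)
          (simp only: abs_mult, intro mult_right_mono less_imp_le[OF c(1)] abs_ge_zero)
      also have "\<dots> = \<epsilon> / M * (\<Sum>b\<in>fst ` B. \<bar>ys i (snd (l b))\<bar>)" by (simp add: sum_distrib_left)
      also have "\<dots> < \<epsilon> / M * M"
      proof (rule mult_strict_left_mono)
        have "(\<Sum>b\<in>fst ` B. \<bar>ys i (snd (l b))\<bar>) \<le> (\<Sum>i\<in>I. \<Sum>b\<in>fst ` B. \<bar>ys i (snd (l b))\<bar>)"
          using i I(1) by (intro member_le_sum[of i I "\<lambda>i. \<Sum>b\<in>fst ` B. \<bar>ys i (snd (l b))\<bar>"]) (auto intro: sum_nonneg)
        then show "(\<Sum>b\<in>fst ` B. \<bar>ys i (snd (l b))\<bar>) < M" by (simp add: M_def)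
      qed (use e M in simp)
      finally show ?thesis using M by simp
    qed
    ultimately show "\<exists>k. (h, k) \<in> Q \<and> (\<forall>i\<in>I. \<bar>ys i k\<bar> < \<epsilon>)" by (metis prod.collapse)
  qed
qed

section \<open>Relative interiors of graph, domain and values\<close>

text \<open>A displacement \<open>h\<close> of \<open>x0\<close> in the direction space of the domain is answered by a displacement
  \<open>k\<close> of \<open>y0\<close> that keeps the equation and the tight constraints; if \<open>h\<close> is small, \<open>k\<close> can be chosen so
  that the slack constraints survive.\<close>

lemma intrinsic_core_graph_domain:
  fixes F :: "'x::lc_hausdorff_tvs \<Rightarrow> 'y::lc_hausdorff_tvs set"
    and A1 :: "'x \<Rightarrow> 'z::lc_hausdorff_tvs" and A2 :: "'y \<Rightarrow> 'z"
  assumes A1: "linear A1" "continuous_on UNIV A1"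
    and A2: "linear A2" "closed_under_finite_codim A2"
    and I: "finite I"
    and xs: "\<And>i. i \<in> I \<Longrightarrow> xs i \<in> topological_dual"
    and ys: "\<And>i. i \<in> I \<Longrightarrow> ys i \<in> topological_dual"
    and G: "mf_gph F = {(x, y). A1 x + A2 y = z \<and> (\<forall>i\<in>I. xs i x + ys i y \<le> \<beta> i)}"
    and p0: "(x0, y0) \<in> intrinsic_core (mf_gph F)"
  shows "x0 \<in> ri (mf_dom F)"
proof -
  have X: "linear (xs i)" and Y: "linear (ys i)" if "i \<in> I" for i
    using xs[OF that] ys[OF that] by (auto simp: topological_dual_def)
  have dom: "mf_dom F = {x. \<exists>y. (x, y) \<in> mf_gph F}" by (auto simp: mf_dom_def mf_gph_def)
  have p0G: "A1 x0 + A2 y0 = z" "\<And>i. i \<in> I \<Longrightarrow> xs i x0 + ys i y0 \<le> \<beta> i" "(x0, y0) \<in> mf_gph F"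
    using p0 by (auto simp: intrinsic_core_def G)
  define J where "J = {i \<in> I. xs i x0 + ys i y0 = \<beta> i}"
  define Q where "Q = {(h, k). A1 h + A2 k = 0 \<and> (\<forall>i\<in>J. xs i h + ys i k = 0)}"
  define E where "E = (+) x0 ` (fst ` Q)"
  have J: "J \<subseteq> I" by (auto simp: J_def)
  have xsJ: "\<And>i. i \<in> J \<Longrightarrow> xs i \<in> topological_dual" using J xs by blast
  note system = projected_linear_system[where xs = xs and ys = ys, OF A1 A2 I J xsJ ys, folded Q_def]
  have active: "xs i x + ys i y = \<beta> i" if "(x, y) \<in> mf_gph F" "i \<in> J" for x y i
  proof -
    have i: "i \<in> I" using that J by blast
    have "linear (\<lambda>p. xs i (fst p) + ys i (snd p))"
      by (rule linearI) (simp_all add: linear_add[OF X] linear_add[OF Y]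
          linear_scale[OF X] linear_scale[OF Y] i algebra_simps)
    from intrinsic_core_maximum[OF this p0 that(1)] show ?thesis
      using that(2) i by (auto simp: G J_def)
  qed
  show ?thesis
  proof (rule riI_affine[of x0 "mf_dom F" E])
    show "x0 \<in> mf_dom F" using p0G(3) by (auto simp: dom)
    show "mf_dom F \<subseteq> E"
    proof
      fix x assume "x \<in> mf_dom F"
      then obtain y where xy: "(x, y) \<in> mf_gph F" by (auto simp: dom)
      have "xs i (x - x0) + ys i (y - y0) = 0" if "i \<in> J" for i
        using active[OF xy that] active[OF p0G(3) that] J that
        by (auto simp: linear_diff[OF X] linear_diff[OF Y] subset_iff)
      moreover have "A1 (x - x0) + A2 (y - y0) = (A1 x + A2 y) - (A1 x0 + A2 y0)"
        by (simp add: linear_diff[OF A1(1)] linear_diff[OF A2(1)])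
      moreover have "A1 x + A2 y = z" using xy by (simp add: G)
      ultimately have "(x - x0, y - y0) \<in> Q" using p0G(1) by (simp add: Q_def)
      then show "x \<in> E" unfolding E_def by (force intro: image_eqI[of _ _ "x - x0"])
    qed
    show "affine E" unfolding E_def
      using system(1) by (simp add: affine_translation[symmetric] subspace_imp_affine)
    have "E = (\<lambda>x. x - x0) -` (fst ` Q)" unfolding E_def by (force simp: image_iff algebra_simps)
    moreover have "continuous_on UNIV (\<lambda>x. x - x0)"
      by (simp add: continuous_on_def tendsto_diff)
    ultimately show "closed E" using system(2) by (simp add: closed_vimage)
    (* the least slack; the 1 covers the case that all constraints are tight *)
    define \<delta> where "\<delta> = Min (insert 1 ((\<lambda>i. \<beta> i - (xs i x0 + ys i y0)) ` (I - J)))"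
    have \<delta>: "\<delta> > 0" "\<And>i. i \<in> I - J \<Longrightarrow> \<delta> \<le> \<beta> i - (xs i x0 + ys i y0)"
    proof -
      show "\<delta> > 0" unfolding \<delta>_def using I p0G(2)
        by (subst Min_gr_iff) (auto simp: J_def order.strict_iff_order)
      show "\<delta> \<le> \<beta> i - (xs i x0 + ys i y0)" if "i \<in> I - J" for i
        unfolding \<delta>_def using I that by (intro Min_le) auto
    qed
    have "\<forall>\<^sub>F h in nhds 0. \<forall>i\<in>I. xs i h < \<delta> / 2"
      using I xs \<delta>(1) by (intro eventually_ball_finite ballI dual_small) auto
    moreover have "\<forall>\<^sub>F h in nhds 0. h \<in> fst ` Q \<longrightarrow> (\<exists>k. (h, k) \<in> Q \<and> (\<forall>i\<in>I. \<bar>ys i k\<bar> < \<delta> / 2))"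
      using \<delta>(1) by (intro system(3)) auto
    ultimately show "\<forall>\<^sub>F h in nhds 0. x0 + h \<in> E \<longrightarrow> x0 + h \<in> mf_dom F"
    proof eventually_elim
      case (elim h)
      show ?case
      proof
        assume "x0 + h \<in> E"
        then have "h \<in> fst ` Q" by (auto simp: E_def intro: rev_image_eqI)
        then obtain k where k: "(h, k) \<in> Q" "\<And>i. i \<in> I \<Longrightarrow> \<bar>ys i k\<bar> < \<delta> / 2" using elim by blast
        have "A1 (x0 + h) + A2 (y0 + k) = (A1 x0 + A2 y0) + (A1 h + A2 k)"
          by (simp add: linear_add[OF A1(1)] linear_add[OF A2(1)] algebra_simps)
        then have "A1 (x0 + h) + A2 (y0 + k) = z" using k(1) p0G(1) by (simp add: Q_def)
        moreover have "xs i (x0 + h) + ys i (y0 + k) \<le> \<beta> i" if i: "i \<in> I" for i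
        proof -
          have eq: "xs i (x0 + h) + ys i (y0 + k) = (xs i x0 + ys i y0) + (xs i h + ys i k)"
            using i by (simp add: linear_add[OF X] linear_add[OF Y])
          show ?thesis
          proof (cases "i \<in> J")
            case True
            then show ?thesis using k(1) unfolding eq by (auto simp: Q_def J_def)
          next
            case False
            then show ?thesis
              using \<delta>(2)[of i] k(2)[OF i] elim(1)[rule_format, OF i] i unfolding eq by auto
          qed
        qed
        ultimately have "(x0 + h, y0 + k) \<in> mf_gph F" by (simp add: G)
        then show "x0 + h \<in> mf_dom F" by (auto simp: dom)
      qed
    qed
  qed
qed

lemma gen_polyhedral_convex_fiber:
  fixes A1 :: "'x \<Rightarrow> 'z::lc_hausdorff_tvs" and A2 :: "'y::lc_hausdorff_tvs \<Rightarrow> 'z"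
  assumes A2: "linear A2" "continuous_on UNIV A2"
    and ys: "\<And>i. i \<in> {1..m::nat} \<Longrightarrow> ys i \<in> topological_dual"
    and G: "mf_gph F = {(x, y). A1 x + A2 y = z \<and> (\<forall>i\<in>{1..m}. xs i x + ys i y \<le> \<beta> i)}"
  shows "gen_polyhedral_convex (F x)"
proof -
  define L where "L = {y. A2 y = z - A1 x}"
  have "closed L" unfolding L_def using A2(2) by (intro closed_Collect_eq continuous_on_const)
  moreover have "affine L"
    unfolding affine_def L_def
    by (auto simp: linear_add[OF A2(1)] linear_scale[OF A2(1)] scaleR_left_distrib[symmetric])
  moreover have "F x = L \<inter> {y. \<forall>i\<in>{1..m}. ys i y \<le> \<beta> i - xs i x}"
  proof -
    have "y \<in> F x \<longleftrightarrow> (x, y) \<in> mf_gph F" for y by (simp add: mf_gph_def)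
    then show ?thesis by (auto simp: G L_def algebra_simps)
  qed
  ultimately show ?thesis unfolding gen_polyhedral_convex_def using ys
    by (intro exI[of _ L] exI[of _ m] exI[of _ ys] exI[of _ "\<lambda>i. \<beta> i - xs i x"]) auto
qed

theorem theorem5p3:
  fixes F :: "'x::lc_hausdorff_tvs \<Rightarrow> 'y::lc_hausdorff_tvs set"
    and A1 :: "'x \<Rightarrow> 'z::lc_hausdorff_tvs"
    and A2 :: "'y \<Rightarrow> 'z"
    and z :: 'z
    and m :: nat
    and xs :: "nat \<Rightarrow> 'x \<Rightarrow> real"
    and ys :: "nat \<Rightarrow> 'y \<Rightarrow> real"
    and \<beta> :: "nat \<Rightarrow> real"
  assumes "gen_polyhedral_convex_mf F"
    and "linear A1" "continuous_on UNIV A1"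
    and "linear A2" "continuous_on UNIV A2"
    and "\<And>i. i \<in> {1..m} \<Longrightarrow> xs i \<in> topological_dual"
    and "\<And>i. i \<in> {1..m} \<Longrightarrow> ys i \<in> topological_dual"
    and "mf_gph F = {(x, y). A1 x + A2 y = z \<and> (\<forall>i\<in>{1..m}. xs i x + ys i y \<le> \<beta> i)}"
    and "closed_under_finite_codim A2"
  shows "ri (mf_gph F) = {(x, y). x \<in> ri (mf_dom F) \<and> y \<in> ri (F x)}"
proof -
  have gpc: "gen_polyhedral_convex (mf_gph F)"
    using assms(1) by (simp add: gen_polyhedral_convex_mf_def)
  have "x \<in> ri (mf_dom F) \<and> y \<in> ri (F x)" if "(x, y) \<in> ri (mf_gph F)" for x y
  proof
    have p: "(x, y) \<in> intrinsic_core (mf_gph F)" using that ri_subset_intrinsic_core by blast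
    show "x \<in> ri (mf_dom F)"
      using assms(2-4,9) finite_atLeastAtMost assms(6-8) p by (rule intrinsic_core_graph_domain)
    have "gen_polyhedral_convex (F x)"
      using assms(4,5,7,8) by (rule gen_polyhedral_convex_fiber)
    then show "y \<in> ri (F x)"
      using intrinsic_core_graph_fiber[OF p] intrinsic_core_subset_ri by blast
  qed
  moreover have "(x, y) \<in> ri (mf_gph F)" if "x \<in> ri (mf_dom F)" "y \<in> ri (F x)" for x y
  proof -
    have "(x, y) \<in> intrinsic_core (mf_gph F)"
      using gen_polyhedral_convex_imp_convex[OF gpc] subsetD[OF ri_subset_intrinsic_core that(1)]
        subsetD[OF ri_subset_intrinsic_core that(2)]
      by (rule intrinsic_core_graphI)
    then show ?thesis using intrinsic_core_subset_ri[OF gpc] by blast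
  qed
  ultimately show ?thesis by auto
qed

end
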